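(* For every positive integer $N$ and every integer $n\ge0$, \[ \alpha_{n}^{(2N)}=i\,(4Nn+2N)!\sum_{l=0}^{2n}(-1)^{l}\frac{\alpha_{2n-l}^{(N)}\,\alpha_{l}^{(N)}}{(4Nn-2Nl+N)!\,(2Nl+N)!}. \]
   Context: For each positive integer $M$, the numbers $\alpha_k^{(M)}$ ($k\ge0$) are defined by the expansion \[ \prod_{j=0}^{M-1}\sinh\!\left(z e^{i j\pi/M}\right)=\sum_{k\ge0}\alpha_{k}^{(M)}\frac{z^{2kM+M}}{(2kM+M)!}. \] *)

theory Defs
  imports "HOL-Complex_Analysis.Complex_Analysis"
begin

definition sinh_prod :: "nat \<Rightarrow> complex \<Rightarrow> complex" where
  "sinh_prod M z = (\<Prod>j<M. sinh (z * exp (\<i> * of_nat j * of_real pi / of_nat M)))"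

text \<open>
  The defining expansion is required for every complex argument. For \<open>M > 0\<close> exactly one
  coefficient sequence satisfies it (\<open>alpha_sums\<close>, \<open>alpha_unique\<close> below), so the definite
  description is well defined; for \<open>M = 0\<close> the value is unspecified.
\<close>
definition alpha :: "nat \<Rightarrow> nat \<Rightarrow> complex" where
  "alpha M = (THE a. \<forall>z. (\<lambda>k. a k * (z ^ (2*k*M + M) / fact (2*k*M + M))) sums sinh_prod M z)"

lemma powser_coeffs_unique:
  fixes a b :: "nat \<Rightarrow> complex"
  assumes "\<And>z. (\<lambda>n. a n * z ^ n) sums f z" "\<And>z. (\<lambda>n. b n * z ^ n) sums f z"
  shows "a = b"
proof -
  have "f has_fps_expansion Abs_fps a" "f has_fps_expansion Abs_fps b"
    by (rule has_fps_expansionI, simp add: assms)+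
  then have "Abs_fps a = Abs_fps b"
    using fps_expansion_unique_complex by blast
  then show ?thesis
    by (simp add: Abs_fps_inject)
qed

lemma sinh_prod_rotate:
  assumes "M > 0"
  shows "sinh_prod M (exp (\<i> * of_real pi / of_nat M) * z) = - sinh_prod M z"
proof -
  define g where "g j = sinh (z * exp (\<i> * of_nat j * of_real pi / of_nat M))" for j :: nat
  obtain m where m: "M = Suc m"
    using assms gr0_implies_Suc by blast
  have "sinh (exp (\<i> * of_real pi / of_nat M) * z * exp (\<i> * of_nat j * of_real pi / of_nat M))
      = g (Suc j)" for j
  proof -
    have "exp (\<i> * of_real pi / of_nat M) * exp (\<i> * of_nat j * of_real pi / of_nat M)
        = exp (\<i> * of_nat (Suc j) * of_real pi / of_nat M)"
      by (simp add: exp_add [symmetric] algebra_simps add_divide_distrib)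
    then show ?thesis
      by (simp add: g_def mult_ac)
  qed
  then have "sinh_prod M (exp (\<i> * of_real pi / of_nat M) * z) = (\<Prod>j<Suc m. g (Suc j))"
    by (simp add: sinh_prod_def m)
  also have "\<dots> = (\<Prod>j<m. g (Suc j)) * g M"
    by (simp add: m)
  also have "g M = - g 0"
    using assms by (simp add: g_def)
  also have "(\<Prod>j<m. g (Suc j)) * - g 0 = - (\<Prod>j<Suc m. g j)"
    by (simp only: prod.lessThan_Suc_shift) simp
  finally show ?thesis
    by (simp add: sinh_prod_def g_def m)
qed

lemma exponents_mono: "M > 0 \<Longrightarrow> strict_mono (\<lambda>k. 2*k*M + M :: nat)"
  by (simp add: strict_mono_def)

lemma ex1_alpha:
  assumes M: "M > 0"
  shows "\<exists>!a. \<forall>z. (\<lambda>k. a k * (z ^ (2*k*M + M) / fact (2*k*M + M))) sums sinh_prod M z"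
proof -
  define g :: "nat \<Rightarrow> nat" where "g k = 2*k*M + M" for k
  define w where "w = exp (\<i> * of_real pi / of_nat M)"
  define c where "c n = (deriv ^^ n) (sinh_prod M) 0 / fact n" for n
  have g: "strict_mono g"
    using exponents_mono [OF M] by (simp add: g_def [abs_def])
  then have inj: "inj g"
    by (rule strict_mono_imp_inj_on)
  have hol: "sinh_prod M holomorphic_on ball 0 r" for r
    unfolding sinh_prod_def sinh_def scaleR_conv_of_real by (intro holomorphic_intros)
  have c: "(\<lambda>n. c n * z ^ n) sums sinh_prod M z" for z
    using holomorphic_power_series [OF hol [of "norm z + 1"], of z] by (simp add: c_def)
  have "(\<lambda>n. - (c n * w ^ n)) = c"
  proof (rule powser_coeffs_unique)
    show "(\<lambda>n. - (c n * w ^ n) * z ^ n) sums sinh_prod M z" for z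
      using sums_minus [OF c [of "w * z"]] sinh_prod_rotate [OF M, of z]
      by (simp add: w_def power_mult_distrib mult_ac)
  qed (rule c)
  then have cw: "- (c n * w ^ n) = c n" for n
    by (rule fun_cong)
  have zero: "c n = 0" if "n \<notin> range g" for n
  proof (rule ccontr)
    assume "c n \<noteq> 0"
    moreover have "c n * (w ^ n + 1) = 0"
      using cw [of n] by (simp add: distrib_left neg_eq_iff_add_eq_0)
    ultimately have "w ^ n = -1"
      by (simp add: eq_neg_iff_add_eq_0)
    then have "exp (of_nat n * (\<i> * of_real pi / of_nat M)) = exp (\<i> * of_real pi)"
      unfolding exp_of_nat_mult by (simp add: w_def)
    then obtain k :: int where
      k: "of_nat n * (\<i> * of_real pi / of_nat M) = \<i> * of_real pi + of_int (2 * k) * of_real pi * \<i>"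
      by (subst (asm) exp_eq) auto
    have "of_real (real n * pi / real M) = (of_real (pi + 2 * of_int k * pi) :: complex)"
      using k by (simp add: algebra_simps) (simp add: complex_eq_iff)
    then have "real n * pi / real M = pi + 2 * of_int k * pi"
      using of_real_eq_iff by blast
    then have "pi * real n = pi * (real M * (2 * of_int k + 1))"
      using M by (simp add: field_simps)
    then have "real n = real M * (2 * of_int k + 1)"
      by (simp only: mult_cancel_left) simp
    then have "real_of_int (int n) = real_of_int (int M * (2 * k + 1))"
      by simp
    then have n: "int n = int M * (2 * k + 1)"
      by (simp only: of_int_eq_iff)
    then have "0 \<le> k"
      using M zero_le_mult_iff [of "int M" "2 * k + 1"] by auto
    then have "int n = int (g (nat k))"
      using n by (simp add: g_def algebra_simps)
    then show False
      using that by auto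
  qed
  show ?thesis
  proof (rule ex1I [of _ "\<lambda>k. c (g k) * fact (g k)"], intro allI)
    fix z
    have "(\<lambda>k. c (g k) * z ^ g k) sums sinh_prod M z"
      by (subst sums_mono_reindex [OF g, of "\<lambda>n. c n * z ^ n"]) (simp_all add: zero c)
    then show "(\<lambda>k. c (g k) * fact (g k) * (z ^ (2*k*M + M) / fact (2*k*M + M))) sums sinh_prod M z"
      by (simp add: g_def)
  next
    fix a
    assume a: "\<forall>z. (\<lambda>k. a k * (z ^ (2*k*M + M) / fact (2*k*M + M))) sums sinh_prod M z"
    define b where "b n = (if n \<in> range g then a (inv g n) / fact n else 0)" for n
    have "b = c"
    proof (rule powser_coeffs_unique)
      show "(\<lambda>n. b n * z ^ n) sums sinh_prod M z" for z
      proof (subst sums_mono_reindex [OF g, symmetric])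
        show "(\<lambda>k. b (g k) * z ^ g k) sums sinh_prod M z"
          using a inj by (simp add: b_def inv_f_f) (simp add: g_def)
      qed (simp add: b_def)
    qed (rule c)
    moreover have "a k = b (g k) * fact (g k)" for k
      using inj by (simp add: b_def inv_f_f)
    ultimately show "a = (\<lambda>k. c (g k) * fact (g k))"
      by (simp add: fun_eq_iff)
  qed
qed

lemma alpha_sums:
  assumes "M > 0"
  shows "(\<lambda>k. alpha M k * (z ^ (2*k*M + M) / fact (2*k*M + M))) sums sinh_prod M z"
  using theI' [OF ex1_alpha [OF assms]] unfolding alpha_def by blast

lemma alpha_unique:
  assumes "M > 0"
    and "\<And>z. (\<lambda>k. a k * (z ^ (2*k*M + M) / fact (2*k*M + M))) sums sinh_prod M z"
  shows "a = alpha M"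
  using ex1_alpha [OF assms(1)] alpha_sums [OF assms(1)] assms(2) by blast

end

theory Submission
  imports Defs
begin

text \<open>
  Splitting the product for \<open>2N\<close> by the parity of the index gives
  \<open>sinh_prod (2N) z = sinh_prod N z * sinh_prod N (w z)\<close> with \<open>w = exp (i \<pi> / (2N))\<close>, and
  \<open>w ^ (2kN + N) = i (-1) ^ k\<close>. In the Cauchy product of the two expansions, the coefficients
  of odd index vanish by antisymmetry and those of even index give the claim.
\<close>

text \<open>Index \<open>2*j\<close> has the angle j pi / N; index \<open>2*j+1\<close> has that
  angle plus pi / (2N), and this shift is absorbed into the argument.\<close>

lemma sinh_prod_double:
  assumes "N > 0"
  shows "sinh_prod (2*N) z =
    sinh_prod N z * sinh_prod N (exp (\<i> * of_real pi / of_nat (2*N)) * z)"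
proof -
  define g where "g j = sinh (z * exp (\<i> * of_nat j * of_real pi / of_nat (2*N)))" for j :: nat
  have split: "(\<Prod>j<2*m. g j) = (\<Prod>j<m. g (2*j)) * (\<Prod>j<m. g (2*j+1))" for m
    by (induction m) (simp_all add: mult_ac)
  have "g (2*j) = sinh (z * exp (\<i> * of_nat j * of_real pi / of_nat N))" for j
    by (simp add: g_def mult_ac)
  moreover have "g (2*j+1) = sinh (exp (\<i> * of_real pi / of_nat (2*N)) * z
      * exp (\<i> * of_nat j * of_real pi / of_nat N))" for j
  proof -
    have "\<i> * of_nat (2*j+1) * of_real pi / of_nat (2*N)
        = \<i> * of_real pi / of_nat (2*N) + \<i> * of_nat j * of_real pi / (of_nat N :: complex)"
      using assms by (simp add: field_simps)
    then show ?thesis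
      by (simp add: g_def exp_add mult_ac)
  qed
  ultimately show ?thesis
    using split[of N] by (simp add: sinh_prod_def g_def)
qed

text \<open>The N-th power of the root is \<i>, and the exponent is N times the odd number 2k +
  1.\<close>

lemma half_root_power:
  assumes "N > 0"
  shows "exp (\<i> * of_real pi / of_nat (2*N)) ^ (2*k*N + N) = \<i> * (-1) ^ k"
proof -
  have "exp (\<i> * of_real pi / of_nat (2*N)) ^ N = exp (\<i> * of_real pi / 2)"
    using assms by (subst exp_of_nat_mult[symmetric]) simp
  also have "\<dots> = \<i>"
    using cis_pi_half by (simp add: cis_conv_exp)
  finally have "exp (\<i> * of_real pi / of_nat (2*N)) ^ N = \<i>" .
  moreover have "2*k*N + N = N * (2*k + 1)"
    by (simp add: algebra_simps)
  ultimately show ?thesis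
    by (simp only: power_mult power_add) (simp add: power_mult)
qed

text \<open>Absolute convergence is what the Cauchy product requires. It follows from convergence at
  a point of larger modulus.\<close>

lemma alpha_abs_summable:
  assumes "M > 0"
  shows "summable (\<lambda>k. norm (alpha M k * (z ^ (2*k*M + M) / fact (2*k*M + M))))"
proof (cases "z = 0")
  case True
  then show ?thesis
    using assms by (simp add: power_0_left)
next
  case False
  define A where "A k = alpha M k / fact (2*k*M + M)" for k
  \<comment> \<open>Taking out \<open>u ^ M\<close> leaves an ordinary power series in
    \<open>u ^ (2*M)\<close>, to which the disc of convergence argument applies.\<close>
  have eq: "alpha M k * (u ^ (2*k*M + M) / fact (2*k*M + M)) = u ^ M * (A k * (u ^ (2*M)) ^ k)"
    for u k
    by (simp add: A_def power_add power_mult[symmetric] mult_ac)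
  \<comment> \<open>The point \<open>2*z\<close> serves only as one strictly farther from 0 than
    \<open>z\<close>.\<close>
  have "summable (\<lambda>k. (2*z) ^ M * (A k * ((2*z) ^ (2*M)) ^ k))"
    using alpha_sums[OF assms, of "2*z"] unfolding eq by (rule sums_summable)
  then have "summable (\<lambda>k. A k * ((2*z) ^ (2*M)) ^ k)"
    using False by (subst (asm) summable_cmult_iff) simp
  moreover have "norm (z ^ (2*M)) < norm ((2*z) ^ (2*M))"
    using False assms unfolding norm_power by (intro power_strict_mono) (simp_all add: norm_mult)
  ultimately have "summable (\<lambda>k. norm (A k * (z ^ (2*M)) ^ k))"
    by (rule powser_insidea)
  then have "summable (\<lambda>k. norm (z ^ M) * norm (A k * (z ^ (2*M)) ^ k))"
    by (rule summable_mult)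
  then show ?thesis
    unfolding eq by (simp add: norm_mult)
qed

text \<open>The reflection of \<open>l\<close> to \<open>m - l\<close> preserves the product but
  flips the sign, since \<open>l\<close> and \<open>m - l\<close> have opposite parity. So the sum
  equals its own negative.\<close>

lemma alternating_convolution_odd:
  fixes f :: "nat \<Rightarrow> 'a :: {idom, ring_char_0}"
  assumes "odd m"
  shows "(\<Sum>l\<le>m. (-1) ^ l * (f (m - l) * f l)) = 0" (is "?S = 0")
proof -
  have "?S = (\<Sum>l\<le>m. (-1) ^ (m - l) * (f (m - (m - l)) * f (m - l)))"
    by (rule sum.nat_diff_reindex[symmetric, where n = "Suc m", simplified lessThan_Suc_atMost
          diff_Suc_Suc])
  also have "\<dots> = (\<Sum>l\<le>m. - ((-1) ^ l * (f (m - l) * f l)))"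
  proof (rule sum.cong[OF refl])
    fix l assume "l \<in> {..m}"
    then show "(-1) ^ (m - l) * (f (m - (m - l)) * f (m - l)) = - ((-1) ^ l * (f (m - l) * f l))"
      using assms by (cases "even l") (simp_all add: mult_ac)
  qed
  finally have "?S = - ?S"
    by (simp add: sum_negf)
  then show ?thesis
    by (simp add: eq_neg_iff_add_eq_0 flip: mult_2)
qed

theorem theorem1:
  fixes N n :: nat
  assumes "N > 0"
  shows "alpha (2*N) n =
    \<i> * fact (4*N*n + 2*N) *
      (\<Sum>l=0..2*n. (-1) ^ l * (alpha N (2*n - l) * alpha N l /
        (fact (4*N*n - 2*N*l + N) * fact (2*N*l + N))))"
proof -
  define w where "w = exp (\<i> * of_real pi / of_nat (2*N))"
  define A where "A k = alpha N k / fact (2*k*N + N)" for k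
  define C where "C m = (\<Sum>l\<le>m. (-1) ^ l * (A (m - l) * A l))" for m
  define t where "t z k = alpha N k * (z ^ (2*k*N + N) / fact (2*k*N + N))" for z k
  \<comment> \<open>The rotated factor carries the index \<open>i\<close>, so
    \<open>half_root_power\<close> supplies exactly the sign \<open>(-1) ^ i\<close> and one factor
    \<i>.\<close>
  have conv: "(\<Sum>i\<le>m. t (w * z) i * t z (m - i)) = \<i> * C m * z ^ (2*m*N + 2*N)" for z m
    unfolding C_def sum_distrib_left sum_distrib_right
  proof (rule sum.cong[OF refl])
    fix i assume "i \<in> {..m}"
    then obtain j where "m = i + j"
      using le_Suc_ex by auto
    then have "2*m*N + 2*N = (2*i*N + N) + (2*(m - i)*N + N)"
      by (simp add: algebra_simps)
    then have "z ^ (2*m*N + 2*N) = z ^ (2*i*N + N) * z ^ (2*(m - i)*N + N)"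
      by (simp only: power_add)
    then show "t (w * z) i * t z (m - i) = \<i> * ((-1) ^ i * (A (m - i) * A i)) * z ^ (2*m*N + 2*N)"
      using half_root_power[OF assms, of i, folded w_def]
      by (simp only: t_def A_def power_mult_distrib) (simp add: mult_ac)
  qed
  \<comment> \<open>By uniqueness it suffices that the claimed sequence satisfies the defining
    expansion for \<open>2*N\<close>.\<close>
  have "(\<lambda>n. \<i> * fact (4*N*n + 2*N) * C (2*n)) = alpha (2*N)"
  proof (rule alpha_unique)
    fix z
    have sums: "(\<lambda>k. t u k) sums sinh_prod N u" "summable (\<lambda>k. norm (t u k))" for u
      using alpha_sums[OF assms] alpha_abs_summable[OF assms] by (simp_all add: t_def)
    have "(\<lambda>m. \<Sum>i\<le>m. t (w * z) i * t z (m - i)) sums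
        ((\<Sum>k. t (w * z) k) * (\<Sum>k. t z k))"
      by (intro Cauchy_product_sums sums)
    then have "(\<lambda>m. \<i> * C m * z ^ (2*m*N + 2*N)) sums sinh_prod (2*N) z"
      by (simp only: conv sums(1)[THEN sums_unique, symmetric]
          sinh_prod_double[OF assms, of z, folded w_def] mult.commute[of "sinh_prod N z"])
    moreover have "C m = 0" if "m \<notin> range (\<lambda>n. 2*n)" for m
    proof -
      have "odd m"
        using that by (auto elim: evenE)
      then show ?thesis
        unfolding C_def by (rule alternating_convolution_odd)
    qed
    \<comment> \<open>With the odd terms gone, setting m = 2n turns the exponents into those of the
      expansion for \<open>2*N\<close>.\<close>
    ultimately have "(\<lambda>n. \<i> * C (2*n) * z ^ (2*(2*n)*N + 2*N)) sums sinh_prod (2*N) z"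
      by (subst sums_mono_reindex[where g = "\<lambda>n. 2*n"
            and f = "\<lambda>m. \<i> * C m * z ^ (2*m*N + 2*N)"]) (auto simp: strict_mono_def)
    then show "(\<lambda>k. \<i> * fact (4*N*k + 2*N) * C (2*k) *
        (z ^ (2*k*(2*N) + 2*N) / fact (2*k*(2*N) + 2*N))) sums sinh_prod (2*N) z"
      by (simp add: mult_ac)
  qed (use assms in simp)
  then have "alpha (2*N) n = \<i> * fact (4*N*n + 2*N) * C (2*n)"
    by (rule fun_cong[symmetric])
  also have "C (2*n) = (\<Sum>l=0..2*n. (-1) ^ l * (alpha N (2*n - l) * alpha N l /
        (fact (4*N*n - 2*N*l + N) * fact (2*N*l + N))))"
    \<comment> \<open>Multiplication distributes over truncated subtraction, so
      \<open>2*(2*n - l)*N\<close> agrees with \<open>4*N*n - 2*N*l\<close>.\<close>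
    unfolding C_def A_def atMost_atLeast0
    by (intro sum.cong) (simp_all add: diff_mult_distrib diff_mult_distrib2 mult_ac)
  finally show ?thesis .
qed

end
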